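(* Let $n,a,b,r$ be positive integers with $n\ge a+b$, and let $\mathcal A\subset\binom{[n]}{a}$, $\mathcal B\subset\binom{[n]}{b}$ be cross-intersecting. Suppose one of the following holds: (i) $a<b$ and $|\mathcal A|\ge r$; (ii) $a=b$ and $|\mathcal A|,|\mathcal B|\ge r$; (iii) $a>b$, $|\mathcal A|\ge r$ and $|\mathcal B|\ge\binom{n}{b}-\binom{n-a+b}{b}+r$. Then for $1\le r\le b-1$, $$|\mathcal A|+|\mathcal B|\le\binom{n}{b}-\binom{n-a+1}{b}+\binom{n-a-r+1}{b-r}+r,$$ and for $b\le r\le n-a+1$, $$|\mathcal A|+|\mathcal B|\le\binom{n}{b}-\binom{n-a+1}{b}+n-a+1.$$
   Context: $\mathcal A,\mathcal B$ are cross-intersecting if $A\cap B\ne\emptyset$ for all $A\in\mathcal A$, $B\in\mathcal B$. *)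

theory Defs
  imports Main
begin

definition cross_intersecting :: "'a set set \<Rightarrow> 'a set set \<Rightarrow> bool" where
  "cross_intersecting \<A> \<B> \<longleftrightarrow> (\<forall>A\<in>\<A>. \<forall>B\<in>\<B>. A \<inter> B \<noteq> {})"

definition ksubsets :: "nat \<Rightarrow> nat \<Rightarrow> nat set set" where
  "ksubsets n k = {S. S \<subseteq> {1..n} \<and> card S = k}"

end

theory Submission
  imports Defs "HOL.Binomial_Plus"
begin

text \<open>Put \<open>k = n - a\<close>. If \<open>card \<A> \<le> k + 1\<close>, the number of \<open>b\<close>-sets missing some member of
  \<open>\<A>\<close> is estimated greedily: the \<open>i\<close>-th member (counting from 0) contributes at least
  \<open>(k - i) choose (b - i)\<close> new ones.

  Otherwise fix a point \<open>x\<close>. Exchanging sets \<open>V\<close> against sets \<open>U\<close> containing \<open>x\<close>,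
  simultaneously in both families and for the smallest \<open>V\<close> that still has an effect, keeps them
  cross-intersecting; in the end each family lies inside the star of \<open>x\<close> or contains it. If
  \<open>\<A>\<close> lies inside the star, pass to the link of \<open>\<A>\<close> and the deletion of \<open>\<B>\<close>: this lowers
  \<open>n\<close> and \<open>a\<close> by one and keeps \<open>k\<close>, while the \<open>b\<close>-sets through \<open>x\<close> account exactly for the
  change of \<open>n choose b\<close>. If \<open>\<A>\<close> contains the star, then \<open>\<B>\<close> lies inside it, and for \<open>a < b\<close>
  comparing the degrees in the disjointness graph suffices. For \<open>a = b\<close> the smaller family lies
  inside the star, leading to \<open>a < b\<close>; for \<open>a > b\<close> the size of \<open>\<B>\<close> forces \<open>\<A>\<close> inside the
  star, leading down to \<open>a = b\<close>.\<close>

section \<open>Compression towards a star\<close>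

text \<open>An arbitrary ground set is allowed because the inductions delete a point, after which it
  need not be an initial segment.\<close>

definition subsets_of_card :: "'a set \<Rightarrow> nat \<Rightarrow> 'a set set" where
  "subsets_of_card S k = {X. X \<subseteq> S \<and> card X = k}"

lemma card_subsets_of_card: "finite S \<Longrightarrow> card (subsets_of_card S k) = card S choose k"
  by (simp add: subsets_of_card_def n_subsets)

lemma finite_subsets_of_card: "finite S \<Longrightarrow> finite (subsets_of_card S k)"
  by (simp add: subsets_of_card_def)

lemma finite_uniform_family:
  assumes "finite S" "F \<subseteq> subsets_of_card S k"
  shows "finite F"
  using assms finite_subsets_of_card finite_subset by blast

lemma cross_intersecting_commute: "cross_intersecting \<A> \<B> \<longleftrightarrow> cross_intersecting \<B> \<A>"
  unfolding cross_intersecting_def by (auto simp: Int_commute)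

definition exchange :: "'a set \<Rightarrow> 'a set \<Rightarrow> 'a set \<Rightarrow> 'a set" where
  "exchange U V X = (X - V) \<union> U"

text \<open>The UV-compression known from Kruskal-Katona arguments: a set whose image is already
  present stays put.\<close>

definition compress :: "'a set \<Rightarrow> 'a set \<Rightarrow> 'a set set \<Rightarrow> 'a set set" where
  "compress U V F = (\<lambda>X. if V \<subseteq> X \<and> U \<inter> X = {} \<and> exchange U V X \<notin> F then exchange U V X else X) ` F"

definition compressed :: "'a set \<Rightarrow> 'a set \<Rightarrow> 'a set set \<Rightarrow> bool" where
  "compressed U V F \<longleftrightarrow> (\<forall>X\<in>F. V \<subseteq> X \<longrightarrow> U \<inter> X = {} \<longrightarrow> exchange U V X \<in> F)"

text \<open>Equal sizes preserve uniformity. Sets of every size are exchanged, since single points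
  alone would not make a family comparable with the star.\<close>

definition exchange_pair :: "'a \<Rightarrow> 'a set \<Rightarrow> 'a set \<Rightarrow> 'a set \<Rightarrow> bool" where
  "exchange_pair x S U V \<longleftrightarrow> x \<in> U \<and> U \<subseteq> S \<and> V \<subseteq> S \<and> U \<inter> V = {} \<and> card U = card V"

text \<open>Two moved sets stay distinct because the exchange is invertible; a moved set lies
  outside \<open>F\<close>, so it cannot collide with an unmoved one.\<close>

lemma card_compress:
  assumes "U \<inter> V = {}"
  shows "card (compress U V F) = card F"
  unfolding compress_def
proof (rule card_image, rule inj_onI)
  have inj: "X = Y" if "V \<subseteq> X" "U \<inter> X = {}" "V \<subseteq> Y" "U \<inter> Y = {}" "exchange U V X = exchange U V Y" for X Y
    using that assms unfolding exchange_def by blast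
  fix X Y assume "X \<in> F" "Y \<in> F" and
    "(if V \<subseteq> X \<and> U \<inter> X = {} \<and> exchange U V X \<notin> F then exchange U V X else X) =
     (if V \<subseteq> Y \<and> U \<inter> Y = {} \<and> exchange U V Y \<notin> F then exchange U V Y else Y)"
  then show "X = Y" using inj by (auto split: if_splits)
qed

lemma exchange_in_subsets:
  assumes "finite S" "exchange_pair x S U V" "X \<in> subsets_of_card S k" "V \<subseteq> X" "U \<inter> X = {}"
  shows "exchange U V X \<in> subsets_of_card S k"
proof -
  have fin: "finite X" "finite U" "finite V"
    using assms finite_subset unfolding exchange_pair_def subsets_of_card_def by blast+
  have "card ((X - V) \<union> U) = card (X - V) + card U"
    using fin assms(5) by (intro card_Un_disjoint) auto
  also have "\<dots> = card X"
    using fin assms card_mono[of X V] by (simp add: card_Diff_subset exchange_pair_def)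
  finally show ?thesis
    using assms unfolding exchange_def subsets_of_card_def exchange_pair_def by auto
qed

lemma compress_subset:
  assumes "finite S" "exchange_pair x S U V" "F \<subseteq> subsets_of_card S k"
  shows "compress U V F \<subseteq> subsets_of_card S k"
  using exchange_in_subsets[OF assms(1,2)] assms(3) unfolding compress_def by auto

lemma compress_cases:
  assumes "Z \<in> compress U V F"
  obtains "Z \<in> F" "V \<subseteq> Z \<Longrightarrow> U \<inter> Z = {} \<Longrightarrow> exchange U V Z \<in> F"
  | X where "X \<in> F" "V \<subseteq> X" "U \<inter> X = {}" "Z = exchange U V X"
  using assms unfolding compress_def by (auto split: if_splits)

text \<open>If \<open>Z\<close> meets \<open>V\<close> in a proper nonempty part \<open>W\<close>, then exchanging \<open>W\<close> against a
  subset of \<open>U\<close> of the same size through \<open>x\<close> produces a member of \<open>\<B>\<close> that misses \<open>X\<close>.\<close>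

lemma compress_disjoint_absurd:
  assumes "finite S" "cross_intersecting \<A> \<B>" "exchange_pair x S U V"
    and small: "\<And>U' V'. exchange_pair x S U' V' \<Longrightarrow> card V' < card V \<Longrightarrow> compressed U' V' \<B>"
    and X: "X \<in> \<A>" "V \<subseteq> X" "U \<inter> X = {}"
    and Z: "Z \<in> \<B>" "V \<subseteq> Z \<Longrightarrow> U \<inter> Z = {} \<Longrightarrow> exchange U V Z \<in> \<B>"
    and disj: "exchange U V X \<inter> Z = {}"
  shows False
proof -
  have meet: "X \<inter> Y \<noteq> {}" if "Y \<in> \<B>" for Y
    using assms(2) X(1) that unfolding cross_intersecting_def by blast
  have UZ: "U \<inter> Z = {}" using disj unfolding exchange_def by blast
  have fin: "finite U" "finite V"
    using assms(1,3) finite_subset unfolding exchange_pair_def by blast+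
  define W where "W = V \<inter> Z"
  show False
  proof (cases "V \<subseteq> Z")
    case True
    have "X \<inter> exchange U V Z = {}" using disj X unfolding exchange_def by blast
    then show False using meet Z(2)[OF True UZ] by blast
  next
    case False
    then have W: "W \<subset> V" unfolding W_def by blast
    then have lt: "card W < card V" using fin psubset_card_mono by blast
    have "W \<noteq> {}" using meet[OF Z(1)] disj X unfolding W_def exchange_def by blast
    then have "card W \<ge> 1" using fin by (simp add: W_def Suc_le_eq card_gt_0_iff)
    have x: "x \<in> U" using assms(3) by (simp add: exchange_pair_def)
    have "card W \<le> card U" using lt assms(3) by (simp add: exchange_pair_def)
    then obtain U' where U': "{x} \<subseteq> U'" "U' \<subseteq> U" "card U' = card W"
      using exists_subset_between[of "{x}" "card W" U] x fin \<open>card W \<ge> 1\<close> by auto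
    have "exchange_pair x S U' W"
      using assms(3) U' W unfolding exchange_pair_def by blast
    then have "compressed U' W \<B>" using small lt by blast
    moreover have "W \<subseteq> Z" by (simp add: W_def)
    moreover have "U' \<inter> Z = {}" using UZ U'(2) by blast
    ultimately have "exchange U' W Z \<in> \<B>"
      using Z(1) by (simp add: compressed_def)
    moreover have "X \<inter> exchange U' W Z = {}"
      using disj X(3) U'(2) unfolding exchange_def W_def by blast
    ultimately show False using meet by blast
  qed
qed

text \<open>Two moved sets share \<open>x\<close>, and two unmoved ones met before. For a mixed
  pair, the family of the unmoved set is stable under smaller exchanges.\<close>

lemma cross_intersecting_compress:
  assumes "finite S" "cross_intersecting \<A> \<B>" "exchange_pair x S U V"
    and smallA: "\<And>U' V'. exchange_pair x S U' V' \<Longrightarrow> card V' < card V \<Longrightarrow> compressed U' V' \<A>"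
    and smallB: "\<And>U' V'. exchange_pair x S U' V' \<Longrightarrow> card V' < card V \<Longrightarrow> compressed U' V' \<B>"
  shows "cross_intersecting (compress U V \<A>) (compress U V \<B>)"
  unfolding cross_intersecting_def
proof (intro ballI notI)
  fix Y Z assume Y: "Y \<in> compress U V \<A>" and Z: "Z \<in> compress U V \<B>" and disj: "Y \<inter> Z = {}"
  have BA: "cross_intersecting \<B> \<A>" using assms(2) cross_intersecting_commute by blast
  show False
  proof (cases rule: compress_cases[OF Y])
    case 1
    note Y1 = 1
    show False
    proof (cases rule: compress_cases[OF Z])
      case 1
      then show False using Y1 disj assms(2) unfolding cross_intersecting_def by blast
    next
      case (2 X)
      show False
        by (rule compress_disjoint_absurd[OF assms(1) BA assms(3) smallA 2(1-3) Y1])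
          (use disj 2(4) in auto)
    qed
  next
    case (2 X)
    note Y2 = 2
    show False
    proof (cases rule: compress_cases[OF Z])
      case 1
      show False
        by (rule compress_disjoint_absurd[OF assms(1,2,3) smallB Y2(1-3) 1])
          (use disj Y2(4) in auto)
    next
      case (2 X')
      have "x \<in> Y \<inter> Z" using 2(4) Y2(4) assms(3) unfolding exchange_def exchange_pair_def by blast
      then show False using disj by blast
    qed
  qed
qed

text \<open>Sets through \<open>x\<close> never move and moved sets acquire \<open>x\<close>, so the
  degree of \<open>x\<close> grows with every effective compression.\<close>

lemma card_star_compress:
  assumes "finite F" "x \<in> U"
  shows "card {X \<in> F. x \<in> X} \<le> card {X \<in> compress U V F. x \<in> X}"
    and "\<not> compressed U V F \<Longrightarrow> card {X \<in> F. x \<in> X} < card {X \<in> compress U V F. x \<in> X}"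
proof -
  have fin: "finite {X \<in> compress U V F. x \<in> X}"
    using assms(1) by (simp add: compress_def)
  have sub: "{X \<in> F. x \<in> X} \<subseteq> {X \<in> compress U V F. x \<in> X}"
    using assms(2) unfolding compress_def by (auto intro!: rev_image_eqI)
  then show "card {X \<in> F. x \<in> X} \<le> card {X \<in> compress U V F. x \<in> X}"
    using card_mono fin by blast
  assume "\<not> compressed U V F"
  then obtain X where X: "X \<in> F" "V \<subseteq> X" "U \<inter> X = {}" "exchange U V X \<notin> F"
    unfolding compressed_def by blast
  then have "exchange U V X \<in> compress U V F"
    unfolding compress_def by (auto intro!: rev_image_eqI[of X])
  moreover have "x \<in> exchange U V X" using assms(2) by (simp add: exchange_def)
  ultimately have "{X \<in> F. x \<in> X} \<subset> {X \<in> compress U V F. x \<in> X}" using sub X(4) by blast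
  then show "card {X \<in> F. x \<in> X} < card {X \<in> compress U V F. x \<in> X}"
    using psubset_card_mono fin by blast
qed

definition star_comparable :: "'a \<Rightarrow> 'a set \<Rightarrow> nat \<Rightarrow> 'a set set \<Rightarrow> bool" where
  "star_comparable x S k F \<longleftrightarrow>
     (\<forall>X\<in>F. x \<in> X) \<or> (\<forall>X\<in>subsets_of_card S k. x \<in> X \<longrightarrow> X \<in> F)"

text \<open>If \<open>X\<close> in \<open>F\<close> avoids \<open>x\<close> while some
  \<open>Y\<close> through \<open>x\<close> is absent, exchanging \<open>X - Y\<close> for
  \<open>Y - X\<close> turns \<open>X\<close> into \<open>Y\<close> and forces \<open>Y\<close> into
  \<open>F\<close>.\<close>

lemma compressed_star_comparable:
  assumes "finite S" "F \<subseteq> subsets_of_card S k" "\<And>U V. exchange_pair x S U V \<Longrightarrow> compressed U V F"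
  shows "star_comparable x S k F"
  unfolding star_comparable_def
proof (rule disjCI, intro ballI)
  assume "\<not> (\<forall>X\<in>subsets_of_card S k. x \<in> X \<longrightarrow> X \<in> F)"
  then obtain Y where Y: "Y \<subseteq> S" "card Y = k" "x \<in> Y" "Y \<notin> F"
    unfolding subsets_of_card_def by blast
  fix X assume X: "X \<in> F"
  then have XS: "X \<subseteq> S" "card X = k" using assms(2) unfolding subsets_of_card_def by blast+
  show "x \<in> X"
  proof (rule ccontr)
    assume "x \<notin> X"
    have fin: "finite X" "finite Y" using XS Y assms(1) finite_subset by blast+
    then have "card (Y - X) = card (X - Y)"
      using XS Y by (metis card_le_sym_Diff dual_order.refl le_antisym)
    then have "exchange_pair x S (Y - X) (X - Y)"
      using XS Y \<open>x \<notin> X\<close> unfolding exchange_pair_def by blast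
    then have "exchange (Y - X) (X - Y) X \<in> F"
      using assms(3) X unfolding compressed_def by blast
    moreover have "exchange (Y - X) (X - Y) X = Y" unfolding exchange_def by blast
    ultimately show False using Y by simp
  qed
qed

text \<open>An extremal choice replaces iterated compression: among cross-intersecting pairs of the
  given sizes, take one with the largest total degree at \<open>x\<close>.\<close>

proposition obtain_star_comparable:
  assumes "finite S" "\<A> \<subseteq> subsets_of_card S a" "\<B> \<subseteq> subsets_of_card S b"
    and "cross_intersecting \<A> \<B>"
  obtains \<A>' \<B>' where "\<A>' \<subseteq> subsets_of_card S a" "\<B>' \<subseteq> subsets_of_card S b"
    "cross_intersecting \<A>' \<B>'" "card \<A>' = card \<A>" "card \<B>' = card \<B>"
    "star_comparable x S a \<A>'" "star_comparable x S b \<B>'"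
proof -
  define P where "P = (\<lambda>(F, G). F \<subseteq> subsets_of_card S a \<and> G \<subseteq> subsets_of_card S b
    \<and> cross_intersecting F G \<and> card F = card \<A> \<and> card G = card \<B>)"
  define w where "w = (\<lambda>(F, G). card {X \<in> F. x \<in> X} + card {X \<in> G. x \<in> X})"
  have "P (\<A>, \<B>)" using assms by (simp add: P_def)
  moreover have "\<forall>p. P p \<longrightarrow> w p < card \<A> + card \<B> + 1"
  proof (intro allI impI)
    fix p assume p: "P p"
    obtain F G where FG: "p = (F, G)" by (cases p)
    have "finite F" "finite G"
      using p finite_uniform_family[OF assms(1)] unfolding P_def FG by auto
    then have "card {X \<in> F. x \<in> X} \<le> card F" "card {X \<in> G. x \<in> X} \<le> card G"
      by (auto intro: card_mono)
    then show "w p < card \<A> + card \<B> + 1" using p by (simp add: P_def w_def FG)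
  qed
  ultimately obtain p where p: "P p" and max: "\<And>q. P q \<Longrightarrow> w q \<le> w p"
    using ex_has_greatest_nat[of P "(\<A>, \<B>)" w "card \<A> + card \<B> + 1"] by metis
  obtain F G where FG: "p = (F, G)" by (cases p)
  have F: "F \<subseteq> subsets_of_card S a" and G: "G \<subseteq> subsets_of_card S b"
    and cross: "cross_intersecting F G" and cards: "card F = card \<A>" "card G = card \<B>"
    using p by (auto simp: P_def FG)
  have fin: "finite F" "finite G"
    using F G finite_uniform_family[OF assms(1)] by auto
  \<comment> \<open>Strong induction on \<open>card V\<close> supplies stability under smaller
    exchanges; an effective compression would then exceed the maximum.\<close>
  have comp: "compressed U V F \<and> compressed U V G" if "exchange_pair x S U V" for U V
    using that
  proof (induction "card V" arbitrary: U V rule: less_induct)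
    case less
    have xU: "x \<in> U" and disj: "U \<inter> V = {}" using less.prems by (auto simp: exchange_pair_def)
    have "cross_intersecting (compress U V F) (compress U V G)"
      using less.hyps cross_intersecting_compress[OF assms(1) cross less.prems] by blast
    then have "P (compress U V F, compress U V G)"
      using compress_subset[OF assms(1) less.prems] F G cards card_compress[OF disj]
      by (auto simp: P_def)
    then have le: "card {X \<in> compress U V F. x \<in> X} + card {X \<in> compress U V G. x \<in> X}
        \<le> card {X \<in> F. x \<in> X} + card {X \<in> G. x \<in> X}"
      using max by (force simp: w_def FG)
    show ?case
      using le card_star_compress[OF fin(1) xU, of V] card_star_compress[OF fin(2) xU, of V]
      by linarith
  qed
  show ?thesis
    by (rule that[OF F G cross cards])
      (use compressed_star_comparable[OF assms(1)] F G comp in blast)+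
qed

text \<open>The complement of a \<open>b\<close>-set avoiding \<open>x\<close> has at least
  \<open>a\<close> points, \<open>x\<close> among them, so it contains an \<open>a\<close>-set of
  the star.\<close>

lemma full_star_cross:
  assumes "finite S" "x \<in> S" "\<B> \<subseteq> subsets_of_card S b" "cross_intersecting \<A> \<B>"
    and "\<forall>X\<in>subsets_of_card S a. x \<in> X \<longrightarrow> X \<in> \<A>" "a > 0" "a + b \<le> card S"
  shows "\<forall>Y\<in>\<B>. x \<in> Y"
proof (rule ballI, rule ccontr)
  fix Y assume Y: "Y \<in> \<B>" "x \<notin> Y"
  then have YS: "Y \<subseteq> S" "card Y = b" using assms(3) unfolding subsets_of_card_def by blast+
  then have "card (S - Y) = card S - b"
    using assms(1) finite_subset by (metis card_Diff_subset)
  then have "a \<le> card (S - Y)" using assms(7) by simp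
  then obtain X where X: "{x} \<subseteq> X" "X \<subseteq> S - Y" "card X = a"
    using exists_subset_between[of "{x}" a "S - Y"] assms(1,2,6) Y(2) by auto
  then have "X \<in> \<A>" using assms(5) unfolding subsets_of_card_def by blast
  then show False using assms(4) Y X unfolding cross_intersecting_def by blast
qed

section \<open>Links and deletions at a point\<close>

definition link :: "'a \<Rightarrow> 'a set set \<Rightarrow> 'a set set" where
  "link x F = (\<lambda>X. X - {x}) ` {X \<in> F. x \<in> X}"

definition deletion :: "'a \<Rightarrow> 'a set set \<Rightarrow> 'a set set" where
  "deletion x F = {X \<in> F. x \<notin> X}"

lemma card_link_deletion:
  assumes "finite F"
  shows "card F = card (link x F) + card (deletion x F)"
proof -
  have "inj_on (\<lambda>X. X - {x}) {X \<in> F. x \<in> X}"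
    by (rule inj_onI) blast
  then have "card (link x F) = card {X \<in> F. x \<in> X}"
    unfolding link_def by (rule card_image)
  moreover have "card F = card {X \<in> F. x \<in> X} + card {X \<in> F. x \<notin> X}"
    using assms by (subst card_Un_disjoint[symmetric]) (auto intro: arg_cong[where f=card])
  ultimately show ?thesis by (simp add: deletion_def)
qed

lemma card_link_star:
  assumes "\<forall>X\<in>F. x \<in> X"
  shows "card F = card (link x F)"
proof -
  have "{X \<in> F. x \<in> X} = F" using assms by blast
  moreover have "inj_on (\<lambda>X. X - {x}) {X \<in> F. x \<in> X}"
    by (rule inj_onI) blast
  ultimately show ?thesis unfolding link_def by (simp add: card_image)
qed

lemma link_subset:
  assumes "finite S" "F \<subseteq> subsets_of_card S k"
  shows "link x F \<subseteq> subsets_of_card (S - {x}) (k - 1)"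
  using assms unfolding link_def subsets_of_card_def by auto

lemma deletion_subset:
  assumes "F \<subseteq> subsets_of_card S k"
  shows "deletion x F \<subseteq> subsets_of_card (S - {x}) k"
  using assms unfolding deletion_def subsets_of_card_def by auto

lemma cross_intersecting_link_deletion:
  assumes "cross_intersecting \<A> \<B>"
  shows "cross_intersecting (link x \<A>) (deletion x \<B>)"
  unfolding cross_intersecting_def
proof (intro ballI)
  fix X Y assume "X \<in> link x \<A>" and Y: "Y \<in> deletion x \<B>"
  then obtain X' where "X' \<in> \<A>" "X = X' - {x}" unfolding link_def by blast
  then show "X \<inter> Y \<noteq> {}" using Y assms unfolding cross_intersecting_def deletion_def by blast
qed

lemma card_link_le:
  assumes "finite S" "x \<in> S" "F \<subseteq> subsets_of_card S k"
  shows "card (link x F) \<le> (card S - 1) choose (k - 1)"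
proof -
  have "card (link x F) \<le> card (subsets_of_card (S - {x}) (k - 1))"
    by (intro card_mono finite_subsets_of_card link_subset) (use assms in auto)
  then show ?thesis using assms by (simp add: card_subsets_of_card)
qed

section \<open>Small first family\<close>

text \<open>Both lower indices have complement \<open>k - b\<close>; after reflection only the upper
  index varies.\<close>

lemma binomial_diagonal_antimono:
  assumes "t \<le> i" "i \<le> b" "b \<le> k"
  shows "(k - i) choose (b - i) \<le> (k - t) choose (b - t)"
proof -
  have "(k - i) choose (b - i) = (k - i) choose (k - b)"
    using assms binomial_symmetric[of "b - i" "k - i"] by simp
  also have "\<dots> \<le> (k - t) choose (k - b)" using assms by (intro binomial_right_mono) simp
  also have "\<dots> = (k - t) choose (b - t)"
    using assms binomial_symmetric[of "b - t" "k - t"] by simp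
  finally show ?thesis .
qed

lemma card_subsets_between:
  assumes "finite S" "T \<subseteq> S" "card T \<le> b"
  shows "card {Y. T \<subseteq> Y \<and> Y \<subseteq> S \<and> card Y = b} = (card S - card T) choose (b - card T)"
proof -
  have finT: "finite T" using assms finite_subset by blast
  have "bij_betw (\<lambda>Y. Y \<union> T) (subsets_of_card (S - T) (b - card T)) {Y. T \<subseteq> Y \<and> Y \<subseteq> S \<and> card Y = b}"
  proof (rule bij_betw_byWitness[where f' = "\<lambda>Y. Y - T"])
    show "(\<lambda>Y. Y \<union> T) ` subsets_of_card (S - T) (b - card T) \<subseteq> {Y. T \<subseteq> Y \<and> Y \<subseteq> S \<and> card Y = b}"
    proof clarify
      fix Y assume Y: "Y \<in> subsets_of_card (S - T) (b - card T)"
      then have "finite Y" "Y \<inter> T = {}" "card Y = b - card T" "Y \<subseteq> S"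
        using assms finite_subset[of Y S] unfolding subsets_of_card_def by auto
      then show "T \<subseteq> Y \<union> T \<and> Y \<union> T \<subseteq> S \<and> card (Y \<union> T) = b"
        using assms finT by (simp add: card_Un_disjoint)
    qed
    show "(\<lambda>Y. Y - T) ` {Y. T \<subseteq> Y \<and> Y \<subseteq> S \<and> card Y = b} \<subseteq> subsets_of_card (S - T) (b - card T)"
      using finT by (auto simp: subsets_of_card_def card_Diff_subset)
  qed (auto simp: subsets_of_card_def)
  from bij_betw_same_card[OF this]
  have "card {Y. T \<subseteq> Y \<and> Y \<subseteq> S \<and> card Y = b} = card (S - T) choose (b - card T)"
    using assms(1) by (simp add: card_subsets_of_card)
  then show ?thesis using assms finT by (simp add: card_Diff_subset)
qed

definition missing :: "'a set \<Rightarrow> nat \<Rightarrow> 'a set set \<Rightarrow> 'a set set" where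
  "missing S b \<A> = {Y \<in> subsets_of_card S b. \<exists>X\<in>\<A>. X \<inter> Y = {}}"

lemma card_add_missing_le:
  assumes "finite S" "\<B> \<subseteq> subsets_of_card S b" "cross_intersecting \<A> \<B>"
  shows "card \<B> + card (missing S b \<A>) \<le> card S choose b"
proof -
  have fin: "finite (subsets_of_card S b)" using assms finite_subsets_of_card by blast
  have sub: "missing S b \<A> \<subseteq> subsets_of_card S b" unfolding missing_def by blast
  have "card \<B> + card (missing S b \<A>) = card (\<B> \<union> missing S b \<A>)"
    using fin sub assms finite_subset unfolding missing_def cross_intersecting_def
    by (intro card_Un_disjoint[symmetric]) auto
  also have "\<dots> \<le> card (subsets_of_card S b)"
    using fin sub assms by (intro card_mono) auto
  finally show ?thesis using assms by (simp add: card_subsets_of_card)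
qed

text \<open>A further set \<open>X\<close> differs from each earlier one in some point outside \<open>X\<close>; every \<open>b\<close>-set
  avoiding \<open>X\<close> and containing all these points is missed for the first time.\<close>

lemma card_missing_ge:
  assumes "finite \<A>" "finite S" "\<A> \<subseteq> subsets_of_card S a" "a + b \<le> card S"
  shows "(\<Sum>i<card \<A>. if i \<le> b then (card S - a - i) choose (b - i) else 0) \<le> card (missing S b \<A>)"
  using assms(1,3)
proof (induction \<A> rule: finite_induct)
  case empty
  then show ?case by simp
next
  case (insert X \<A>)
  have fin: "finite (missing S b F)" for F
    using assms(2) finite_subsets_of_card finite_subset[of "missing S b F" "subsets_of_card S b"]
    unfolding missing_def by blast
  have X: "X \<subseteq> S" "card X = a" and finX: "finite X"
    using insert.prems assms(2) finite_subset unfolding subsets_of_card_def by auto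
  have IH: "(\<Sum>i<card \<A>. if i \<le> b then (card S - a - i) choose (b - i) else 0) \<le> card (missing S b \<A>)"
    using insert by blast
  have mono: "missing S b \<A> \<subseteq> missing S b (insert X \<A>)" unfolding missing_def by blast
  show ?case
  proof (cases "card \<A> \<le> b")
    \<comment> \<open>Beyond index \<open>b\<close> the summand is set to 0, as the truncated
      \<open>b - i\<close> would make it 1; so the sum does not grow here.\<close>
    case False
    then show ?thesis using IH card_mono[OF fin mono] insert.hyps by simp
  next
    case True
    have "\<exists>y. y \<in> Z - X" if "Z \<in> \<A>" for Z
    proof (rule ccontr)
      assume "\<nexists>y. y \<in> Z - X"
      moreover have "card Z = a" using that insert.prems unfolding subsets_of_card_def by blast
      ultimately have "Z = X" using X finX by (metis Diff_iff card_subset_eq subsetI)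
      then show False using that insert.hyps by blast
    qed
    then obtain f where f: "\<And>Z. Z \<in> \<A> \<Longrightarrow> f Z \<in> Z - X" by metis
    define T where "T = f ` \<A>"
    have T: "T \<subseteq> S - X" using f insert.prems unfolding T_def subsets_of_card_def by blast
    have cT: "card T \<le> card \<A>" using insert.hyps by (simp add: T_def card_image_le)
    define N where "N = {Y. T \<subseteq> Y \<and> Y \<subseteq> S - X \<and> card Y = b}"
    have "card (S - X) = card S - a" using X finX by (simp add: card_Diff_subset)
    then have "card N = (card S - a - card T) choose (b - card T)"
      unfolding N_def using card_subsets_between[of "S - X" T b] assms(2) T cT True by simp
    \<comment> \<open>\<open>f\<close> need not be injective; if \<open>T\<close> has fewer points
      than \<A> has members, the count only improves.\<close>
    then have cN: "(card S - a - card \<A>) choose (b - card \<A>) \<le> card N"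
      using binomial_diagonal_antimono[OF cT True, of "card S - a"] assms(4) by simp
    have "missing S b \<A> \<inter> N = {}"
    proof (rule ccontr)
      assume "missing S b \<A> \<inter> N \<noteq> {}"
      then obtain Y Z where "Z \<in> \<A>" "Z \<inter> Y = {}" "T \<subseteq> Y" unfolding missing_def N_def by blast
      then show False using f[of Z] unfolding T_def by blast
    qed
    moreover have N: "N \<subseteq> missing S b (insert X \<A>)"
      unfolding N_def missing_def subsets_of_card_def by blast
    ultimately have "card (missing S b \<A>) + card N \<le> card (missing S b (insert X \<A>))"
      using mono fin by (metis card_Un_disjoint card_mono finite_subset le_sup_iff)
    then show ?thesis using IH cN True insert.hyps by simp
  qed
qed

text \<open>Pascal's rule splits each remainder into the next summand and the next remainder. This
  turns the greedy count into a difference of binomials.\<close>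

lemma sum_binomial_diagonal:
  assumes "m \<le> b" "b \<le> k"
  shows "(\<Sum>i<m. (k - i) choose (b - i)) + ((k + 1 - m) choose (b - m)) = (k + 1) choose b"
  using assms
proof (induction m)
  case (Suc m)
  have "(k + 1 - m) choose (b - m) = ((k - m) choose (b - m)) + ((k - m) choose (b - Suc m))"
    using Suc.prems by (simp add: Suc_diff_le Suc_diff_Suc[of m b, symmetric])
  then show ?case using Suc by simp
qed simp

section \<open>Binomial inequalities\<close>

lemma binomial_le_binomial:
  assumes "a \<le> b" "a + b \<le> n"
  shows "n choose a \<le> n choose b"
proof (cases "2 * b \<le> n")
  case True
  then show ?thesis using assms by (intro binomial_mono)
next
  case False
  then have "n choose a \<le> n choose (n - b)" using assms by (intro binomial_mono) auto
  then show ?thesis using assms binomial_symmetric[of b n] by simp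
qed

lemma le_binomial:
  assumes "0 < j" "j < N"
  shows "N \<le> N choose j"
  using binomial_le_binomial[of 1 j N] assms by simp

text \<open>This is the desired bound when \<A> consists of all \<open>a\<close>-sets and \<B> is
  empty. Pascal's rule reduces it to smaller \<open>n\<close>; at \<open>a = 1\<close> and at
  \<open>n = a + b\<close> it is an equality.\<close>

lemma binomial_add_binomial_le:
  assumes "0 < a" "a < b" "a + b \<le> n"
  shows "(n choose a) + ((n - a + 1) choose b) \<le> (n choose b) + (n - a + 1)"
  using assms
proof (induction n arbitrary: a b)
  case (Suc n)
  consider "a = 1" | "Suc n = a + b" | "a \<ge> 2" "a + b \<le> n" using Suc.prems by linarith
  then show ?case
  proof cases
    case 1
    then show ?thesis by simp
  next
    case 2
    then have "Suc n choose a = Suc n choose b" using binomial_symmetric[of a "Suc n"] by simp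
    moreover have "(Suc n - a + 1) choose b = Suc n - a + 1" using 2 by simp
    ultimately show ?thesis by simp
  next
    case 3
    obtain a' b' where ab: "a = Suc a'" "b = Suc b'" using Suc.prems by (metis less_imp_Suc_add)
    have "(n choose a) + ((n - a + 1) choose b) \<le> (n choose b) + (n - a + 1)"
      using Suc.IH[of a b] 3 Suc.prems by simp
    moreover have "(n choose a') + ((n - a' + 1) choose b') \<le> (n choose b') + (n - a' + 1)"
      using Suc.IH[of a' b'] 3 Suc.prems ab by simp
    moreover have "(n - a' + 1) choose b' = ((n - a') choose b') + ((n - a') choose (b' - 1))"
      using 3 Suc.prems ab by (cases b') auto
    \<comment> \<open>The two induction hypotheses contribute the linear term twice; this binomial,
      left over on the other side, absorbs the extra \<open>n - a'\<close>.\<close>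
    moreover have "n - a' \<le> (n - a') choose (b' - 1)"
      using 3 Suc.prems ab by (intro le_binomial) auto
    moreover have "(Suc n - a + 1) choose b = ((n - a + 1) choose b) + ((n - a') choose b')"
      using 3 ab by (simp add: Suc_diff_le Suc_diff_Suc)
    moreover have "n - a' = n - a + 1" "Suc n - a + 1 = n - a' + 1" using 3 ab by auto
    moreover have "Suc n choose a = (n choose a') + (n choose a)"
      "Suc n choose b = (n choose b') + (n choose b)" using ab by auto
    ultimately show ?thesis by linarith
  qed
qed simp

section \<open>Large first family\<close>

lemma card_disjoint_subsets:
  assumes "finite S" "X \<in> subsets_of_card S a"
  shows "card {Y \<in> subsets_of_card S b. X \<inter> Y = {}} = (card S - a) choose b"
proof -
  have X: "X \<subseteq> S" "card X = a" "finite X"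
    using assms finite_subset unfolding subsets_of_card_def by auto
  have "{Y \<in> subsets_of_card S b. X \<inter> Y = {}} = subsets_of_card (S - X) b"
    unfolding subsets_of_card_def by auto
  then show ?thesis using assms X by (simp add: card_subsets_of_card card_Diff_subset)
qed

text \<open>The disjointness graph between \<open>a\<close>-sets and \<open>b\<close>-sets is biregular, with the larger
  degree on the side of the \<open>a\<close>-sets.\<close>

lemma card_add_card_le:
  assumes "finite S" "\<A> \<subseteq> subsets_of_card S a" "\<B> \<subseteq> subsets_of_card S b"
    and "cross_intersecting \<A> \<B>" "a \<le> b" "a + b \<le> card S"
  shows "card \<A> + card \<B> \<le> card S choose b"
proof -
  let ?n = "card S" and ?D = "missing S b \<A>"
  have finA: "finite \<A>" and finD: "finite ?D"
    using finite_uniform_family[OF assms(1)] assms(2) finite_subsets_of_card[OF assms(1)]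
    unfolding missing_def by auto
  have deg: "card {Y \<in> ?D. X \<inter> Y = {}} = (?n - a) choose b" if "X \<in> \<A>" for X
  proof -
    have "{Y \<in> ?D. X \<inter> Y = {}} = {Y \<in> subsets_of_card S b. X \<inter> Y = {}}"
      using that unfolding missing_def by blast
    then show ?thesis using card_disjoint_subsets[OF assms(1), of X] that assms(2) by auto
  qed
  have deg': "card {X \<in> \<A>. X \<inter> Y = {}} \<le> (?n - b) choose a" if "Y \<in> ?D" for Y
  proof -
    have "card {X \<in> \<A>. X \<inter> Y = {}} \<le> card {X \<in> subsets_of_card S a. Y \<inter> X = {}}"
      using assms finite_subsets_of_card[OF assms(1)] by (intro card_mono) auto
    then show ?thesis using card_disjoint_subsets[OF assms(1), of Y] that unfolding missing_def by auto
  qed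
  have "(?n - b) choose a = (?n - b) choose (?n - a - b)"
    using assms binomial_symmetric[of a "?n - b"] by (simp add: add.commute)
  also have "\<dots> \<le> (?n - a) choose (?n - a - b)"
    using assms by (intro binomial_right_mono) auto
  also have "\<dots> = (?n - a) choose b"
    using assms binomial_symmetric[of b "?n - a"] by simp
  finally have degs: "(?n - b) choose a \<le> (?n - a) choose b" .
  \<comment> \<open>Double counting of the disjoint pairs; the degree cancelled at the end is
    positive because \<open>b \<le> card S - a\<close>.\<close>
  have "card \<A> * ((?n - a) choose b) = (\<Sum>X\<in>\<A>. card {Y \<in> ?D. X \<inter> Y = {}})"
    using deg by simp
  also have "\<dots> = (\<Sum>Y\<in>?D. card {X \<in> \<A>. X \<inter> Y = {}})"
    using sum.swap_restrict[OF finA finD, of "\<lambda>_ _. 1::nat" "\<lambda>X Y. X \<inter> Y = {}"] by simp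
  also have "\<dots> \<le> card ?D * ((?n - b) choose a)"
    using sum_bounded_above[of ?D, OF deg'] by simp
  also have "\<dots> \<le> card ?D * ((?n - a) choose b)"
    using degs by simp
  finally have "card \<A> \<le> card ?D"
    using assms by simp
  then show ?thesis using card_add_missing_le[OF assms(1,3,4)] by linarith
qed

text \<open>Induction on \<open>a\<close>: link and deletion keep \<open>card S - a\<close>, so the
  lower bound on \<open>card \<A>\<close> passes to the link.\<close>

lemma card_add_card_le_of_large:
  assumes "finite S" "\<A> \<subseteq> subsets_of_card S a" "\<B> \<subseteq> subsets_of_card S b"
    and "cross_intersecting \<A> \<B>" "a < b" "a + b \<le> card S" "card S - a + 1 \<le> card \<A>"
  shows "card \<A> + card \<B> + ((card S - a + 1) choose b) \<le> (card S choose b) + (card S - a + 1)"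
  using assms
proof (induction a arbitrary: S \<A> \<B>)
  case 0
  have "card \<A> \<le> card (subsets_of_card S 0)"
    using 0 finite_subsets_of_card by (intro card_mono) auto
  then show ?case using 0 by (simp add: card_subsets_of_card)
next
  case (Suc a)
  let ?n = "card S"
  have "S \<noteq> {}" using Suc.prems by auto
  then obtain x where x: "x \<in> S" by blast
  obtain A B where A: "A \<subseteq> subsets_of_card S (Suc a)" and B: "B \<subseteq> subsets_of_card S b"
    and cross: "cross_intersecting A B" and cards: "card A = card \<A>" "card B = card \<B>"
    and star: "star_comparable x S (Suc a) A"
    using obtain_star_comparable[OF Suc.prems(1-4)] by metis
  have fin: "finite A" "finite B"
    using A B finite_uniform_family[OF Suc.prems(1)] by auto
  have pascal: "?n choose b = ((?n - 1) choose (b - 1)) + ((?n - 1) choose b)"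
    using Suc.prems by (intro choose_reduce_nat) auto
  have n': "card (S - {x}) = ?n - 1" using x Suc.prems by simp
  have linkB: "card (link x B) \<le> (?n - 1) choose (b - 1)"
    using card_link_le[OF Suc.prems(1) x B] .
  show ?case
  proof (cases "\<forall>X\<in>A. x \<in> X")
    case True
    then have cA: "card A = card (link x A)" by (rule card_link_star)
    have "card (link x A) + card (deletion x B) + ((card (S - {x}) - a + 1) choose b)
        \<le> (card (S - {x}) choose b) + (card (S - {x}) - a + 1)"
    proof (rule Suc.IH)
      show "link x A \<subseteq> subsets_of_card (S - {x}) a" using link_subset[OF Suc.prems(1) A] by simp
      show "cross_intersecting (link x A) (deletion x B)"
        by (rule cross_intersecting_link_deletion[OF cross])
    qed (use Suc.prems deletion_subset[OF B] n' cA cards in auto)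
    then show ?thesis
      using pascal linkB card_link_deletion[OF fin(2), of x] cA cards n' by simp
  next
    case False
    then have full: "\<forall>X\<in>subsets_of_card S (Suc a). x \<in> X \<longrightarrow> X \<in> A"
      using star unfolding star_comparable_def by blast
    have "\<forall>Y\<in>B. x \<in> Y"
      using full_star_cross[OF Suc.prems(1) x B cross full] Suc.prems by simp
    then have cB: "card B = card (link x B)" by (rule card_link_star)
    show ?thesis
    proof (cases "a = 0")
      \<comment> \<open>For singletons the size hypothesis forces \<open>A\<close> to contain all of
        them, hence \<open>B\<close> to be empty; the binomial inequality used otherwise requires a
        positive index.\<close>
      case True
      have sub: "card A \<le> card (subsets_of_card S (Suc a))"
        using A finite_subsets_of_card[OF Suc.prems(1)] by (rule card_mono[rotated])
      then have all: "A = subsets_of_card S 1"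
        using True A Suc.prems cards finite_subsets_of_card[OF Suc.prems(1)]
        by (intro card_subset_eq) (auto simp: card_subsets_of_card)
      have "B = {}"
      proof (rule ccontr)
        assume "B \<noteq> {}"
        then obtain Y where Y: "Y \<in> B" "Y \<subseteq> S" "card Y = b"
          using B unfolding subsets_of_card_def by blast
        then have "Y \<noteq> S" using Suc.prems by auto
        then obtain y where "y \<in> S" "y \<notin> Y" using Y by blast
        then have "{y} \<in> A" using all by (simp add: subsets_of_card_def)
        then show False using cross Y \<open>y \<notin> Y\<close> unfolding cross_intersecting_def by blast
      qed
      moreover have "card A = ?n" using sub True Suc.prems cards by (simp add: card_subsets_of_card)
      ultimately have "card A + card B + (?n choose b) = ?n + (?n choose b)" by simp
      then show ?thesis using True cards Suc.prems by simp
    next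
      case False
      \<comment> \<open>Strictness \<open>Suc a < b\<close> enters here, giving
        \<open>Suc a \<le> b - 1\<close>. The link of \<open>A\<close> is merely bounded by the
        number of all \<open>a\<close>-sets avoiding \<open>x\<close>.\<close>
      have "card (deletion x A) + card (link x B) \<le> card (S - {x}) choose (b - 1)"
      proof (rule card_add_card_le)
        show "cross_intersecting (deletion x A) (link x B)"
          using cross_intersecting_link_deletion[of B A x] cross
          by (simp add: cross_intersecting_commute)
      qed (use Suc.prems deletion_subset[OF A] link_subset[OF Suc.prems(1) B] n' in auto)
      moreover have "card (link x A) \<le> (?n - 1) choose a"
        using card_link_le[OF Suc.prems(1) x A] by simp
      moreover have "((?n - 1) choose a) + ((?n - 1 - a + 1) choose b) \<le> ((?n - 1) choose b) + (?n - 1 - a + 1)"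
        using False Suc.prems by (intro binomial_add_binomial_le) auto
      moreover have "?n - 1 - a + 1 = ?n - Suc a + 1" using Suc.prems by simp
      ultimately show ?thesis
        using pascal card_link_deletion[OF fin(1), of x] cB cards n' by simp
    qed
  qed
qed

section \<open>Combining the size regimes\<close>

text \<open>With \<open>k = n - a\<close>, this unites the final terms of the two claimed bounds.
  The bounds below are stated additively to avoid truncated subtraction.\<close>

definition tail_bound :: "nat \<Rightarrow> nat \<Rightarrow> nat \<Rightarrow> nat" where
  "tail_bound k b r = (if r < b then ((k + 1 - r) choose (b - r)) + r else k + 1)"

text \<open>Ensures that the bound with tail \<open>k + 1\<close>, obtained for large \<A>, suffices
  for every \<open>r\<close>.\<close>

lemma le_tail_bound:
  assumes "b \<le> k"
  shows "k + 1 \<le> tail_bound k b r"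
proof (cases "r < b")
  case True
  then have "k + 1 - r \<le> (k + 1 - r) choose (b - r)"
    using assms by (intro le_binomial) auto
  then show ?thesis using True by (simp add: tail_bound_def)
qed (simp add: tail_bound_def)

text \<open>As \<open>m\<close> grows, \<open>m\<close> minus the sum weakly decreases up to
  \<open>m = b + 1\<close>, the summands being at least 1, and increases afterwards. So the extremes
  are \<open>m = r\<close> and \<open>m = k + 1\<close>, both covered by
  \<open>tail_bound\<close>.\<close>

lemma tail_bound_le_sum:
  assumes "r \<le> m" "m \<le> k + 1" "b \<le> k"
  shows "m + ((k + 1) choose b)
    \<le> (\<Sum>i<m. if i \<le> b then (k - i) choose (b - i) else 0) + tail_bound k b r"
proof -
  let ?f = "\<lambda>i. if i \<le> b then (k - i) choose (b - i) else 0"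
  have initial: "(\<Sum>i<l. ?f i) + ((k + 1 - l) choose (b - l)) = (k + 1) choose b" if "l \<le> b" for l
    using sum_binomial_diagonal[OF that assms(3)] that by simp
  have ge1: "1 \<le> ?f i" if "i \<le> b" for i using that assms(3) by (simp add: Suc_le_eq)
  show ?thesis
  proof (cases "m \<le> b + 1")
    case False
    have "(\<Sum>i<b + 1. ?f i) \<le> (\<Sum>i<m. ?f i)"
      using False by (intro sum_mono2) auto
    moreover have "(\<Sum>i<b + 1. ?f i) = (k + 1) choose b"
      using initial[of b] by simp
    ultimately show ?thesis using le_tail_bound[OF assms(3), of r] assms(2) by linarith
  next
    case True
    have sum: "(\<Sum>i<l. ?f i) + (m - l) \<le> (\<Sum>i<m. ?f i)" if "l \<le> m" for l
    proof -
      have "(\<Sum>i<m. ?f i) = (\<Sum>i<l. ?f i) + (\<Sum>i\<in>{l..<m}. ?f i)"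
        using sum.atLeastLessThan_concat[of 0 l m ?f] that by (simp add: lessThan_atLeast0)
      moreover have "(\<Sum>i\<in>{l..<m}. 1) \<le> (\<Sum>i\<in>{l..<m}. ?f i)"
        using ge1 True by (intro sum_mono) auto
      ultimately show ?thesis by simp
    qed
    show ?thesis
    proof (cases "r < b")
      case True
      then show ?thesis using sum[OF assms(1)] initial[of r] assms(1) by (simp add: tail_bound_def)
    next
      case False
      \<comment> \<open>The remainder at \<open>b\<close> is 1, so the left side exceeds the sum by
        at most \<open>b + 1 \<le> k + 1\<close>.\<close>
      then show ?thesis using sum[of b] initial[of b] assms by (simp add: tail_bound_def)
    qed
  qed
qed

lemma bound_of_small:
  assumes "finite S" "\<A> \<subseteq> subsets_of_card S a" "\<B> \<subseteq> subsets_of_card S b"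
    and "cross_intersecting \<A> \<B>" "a + b \<le> card S" "r \<le> card \<A>" "card \<A> \<le> card S - a + 1"
  shows "card \<A> + card \<B> + ((card S - a + 1) choose b)
    \<le> (card S choose b) + tail_bound (card S - a) b r"
proof -
  have "finite \<A>" using finite_uniform_family assms(1,2) by blast
  then have "(\<Sum>i<card \<A>. if i \<le> b then (card S - a - i) choose (b - i) else 0) + card \<B> \<le> card S choose b"
    using card_missing_ge[of \<A> S a b] card_add_missing_le[of S \<B> b \<A>] assms by linarith
  then show ?thesis
    using tail_bound_le_sum[of r "card \<A>" "card S - a" b] assms by linarith
qed

lemma bound_less:
  assumes "finite S" "\<A> \<subseteq> subsets_of_card S a" "\<B> \<subseteq> subsets_of_card S b"
    and "cross_intersecting \<A> \<B>" "a < b" "a + b \<le> card S" "r \<le> card \<A>"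
  shows "card \<A> + card \<B> + ((card S - a + 1) choose b)
    \<le> (card S choose b) + tail_bound (card S - a) b r"
proof (cases "card \<A> \<le> card S - a + 1")
  case True
  show ?thesis by (rule bound_of_small[OF assms(1-4,6,7) True])
next
  case False
  then have "card \<A> + card \<B> + ((card S - a + 1) choose b) \<le> (card S choose b) + (card S - a + 1)"
    using card_add_card_le_of_large[OF assms(1-6)] by linarith
  then show ?thesis using le_tail_bound[of b "card S - a" r] assms(6) by linarith
qed

text \<open>The order of the sizes decides the structure: if \<open>A\<close> contained the star and
  more, \<open>B\<close> would lie inside the star and be strictly smaller than
  \<open>A\<close>.\<close>

lemma bound_equal_ordered:
  assumes "finite S" "\<A> \<subseteq> subsets_of_card S b" "\<B> \<subseteq> subsets_of_card S b"
    and "cross_intersecting \<A> \<B>" "b > 0" "b + b \<le> card S" "r \<le> card \<A>" "card \<A> \<le> card \<B>"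
  shows "card \<A> + card \<B> + ((card S - b + 1) choose b)
    \<le> (card S choose b) + tail_bound (card S - b) b r"
proof (cases "card \<A> \<le> card S - b + 1")
  case True
  show ?thesis by (rule bound_of_small[OF assms(1-4,6,7) True])
next
  case False
  let ?n = "card S"
  have "S \<noteq> {}" using assms by auto
  then obtain x where x: "x \<in> S" by blast
  obtain A B where A: "A \<subseteq> subsets_of_card S b" and B: "B \<subseteq> subsets_of_card S b"
    and cross: "cross_intersecting A B" and cards: "card A = card \<A>" "card B = card \<B>"
    and star: "star_comparable x S b A"
    using obtain_star_comparable[OF assms(1-4)] by metis
  have fin: "finite A" "finite B"
    using A B finite_uniform_family[OF assms(1)] by auto
  have n': "card (S - {x}) = ?n - 1" using x assms(1) by simp
  have "\<forall>X\<in>A. x \<in> X"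
  proof (rule ccontr)
    assume notin: "\<not> (\<forall>X\<in>A. x \<in> X)"
    then have full: "\<forall>X\<in>subsets_of_card S b. x \<in> X \<longrightarrow> X \<in> A"
      using star unfolding star_comparable_def by blast
    have "\<forall>Y\<in>B. x \<in> Y"
      using full_star_cross[OF assms(1) x B cross full] assms by simp
    then have "B \<subset> A" using full B notin by blast
    then have "card B < card A" using fin psubset_card_mono by blast
    then show False using cards assms by simp
  qed
  then have cA: "card A = card (link x A)" by (rule card_link_star)
  have eqs: "card (S - {x}) - (b - 1) = ?n - b" using n' assms by simp
  \<comment> \<open>The link consists of sets of size \<open>b - 1 < b\<close>; for
    \<open>b = 1\<close> this size is 0, which \<open>bound_less\<close> admits.\<close>
  have "card (link x A) + card (deletion x B) + ((card (S - {x}) - (b - 1) + 1) choose b)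
      \<le> (card (S - {x}) choose b) + tail_bound (card (S - {x}) - (b - 1)) b r"
  proof (rule bound_less)
    show "cross_intersecting (link x A) (deletion x B)"
      by (rule cross_intersecting_link_deletion[OF cross])
  qed (use assms deletion_subset[OF B] link_subset[OF assms(1) A] n' cA cards in auto)
  moreover have "card (link x B) \<le> (?n - 1) choose (b - 1)"
    using card_link_le[OF assms(1) x B] .
  moreover have "?n choose b = ((?n - 1) choose (b - 1)) + ((?n - 1) choose b)"
    using assms by (intro choose_reduce_nat) auto
  ultimately show ?thesis
    using card_link_deletion[OF fin(2), of x] cA cards n' unfolding eqs by simp
qed

lemma bound_equal:
  assumes "finite S" "\<A> \<subseteq> subsets_of_card S b" "\<B> \<subseteq> subsets_of_card S b"
    and "cross_intersecting \<A> \<B>" "b > 0" "b + b \<le> card S" "r \<le> card \<A>" "r \<le> card \<B>"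
  shows "card \<A> + card \<B> + ((card S - b + 1) choose b)
    \<le> (card S choose b) + tail_bound (card S - b) b r"
proof (cases "card \<A> \<le> card \<B>")
  case True
  show ?thesis by (rule bound_equal_ordered[OF assms(1-7) True])
next
  case False
  have "cross_intersecting \<B> \<A>" using assms(4) cross_intersecting_commute by blast
  then show ?thesis
    using bound_equal_ordered[of S \<B> b \<A> r] assms False by (simp add: add.commute)
qed

text \<open>The amount required of \<B> beyond \<open>r\<close> is the number of
  \<open>b\<close>-sets meeting a fixed set of \<open>a - b\<close> points. Each reduction removes
  at most the \<open>b\<close>-sets through one point, so after \<open>a - b\<close> reductions at
  least \<open>r\<close> members remain.\<close>

lemma bound_ge:
  assumes "finite S" "\<A> \<subseteq> subsets_of_card S a" "\<B> \<subseteq> subsets_of_card S b"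
    and "cross_intersecting \<A> \<B>" "b > 0" "b \<le> a" "a + b \<le> card S" "0 < r" "r \<le> card \<A>"
    and "(card S choose b) + r \<le> card \<B> + ((card S - a + b) choose b)"
  shows "card \<A> + card \<B> + ((card S - a + 1) choose b)
    \<le> (card S choose b) + tail_bound (card S - a) b r"
  using assms(6,1-5,7-)
proof (induction a arbitrary: S \<A> \<B> rule: dec_induct)
  case base
  then have "card S - b + b = card S" by simp
  with base have "r \<le> card \<B>" by simp
  then show ?case using bound_equal[of S \<A> b \<B> r] base by simp
next
  case (step a)
  note prems = step.prems
  let ?n = "card S"
  have "S \<noteq> {}" using prems by auto
  then obtain x where x: "x \<in> S" by blast
  obtain A B where A: "A \<subseteq> subsets_of_card S (Suc a)" and B: "B \<subseteq> subsets_of_card S b"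
    and cross: "cross_intersecting A B" and cards: "card A = card \<A>" "card B = card \<B>"
    and star: "star_comparable x S b B"
    using obtain_star_comparable[OF prems(1-4)] by metis
  have fin: "finite A" "finite B"
    using A B finite_uniform_family[OF prems(1)] by auto
  have n': "card (S - {x}) = ?n - 1" using x prems(1) by simp
  have pascal: "?n choose b = ((?n - 1) choose (b - 1)) + ((?n - 1) choose b)"
    using prems by (intro choose_reduce_nat) auto
  have linkB: "card (link x B) \<le> (?n - 1) choose (b - 1)"
    using card_link_le[OF prems(1) x B] .
  have mono: "(?n - Suc a + b) choose b \<le> (?n - 1) choose b"
    using step.hyps prems by (intro binomial_right_mono) auto
  \<comment> \<open>Inside the star, \<open>B\<close> would have at most
    \<open>(?n choose b) - ((?n - 1) choose b)\<close> members; by \<open>mono\<close> and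
    \<open>0 < r\<close> the hypothesis demands more.\<close>
  have "\<not> (\<forall>Y\<in>B. x \<in> Y)"
  proof
    assume "\<forall>Y\<in>B. x \<in> Y"
    then have "card B = card (link x B)" by (rule card_link_star)
    then show False using linkB pascal mono prems cards by simp
  qed
  then have full: "\<forall>Y\<in>subsets_of_card S b. x \<in> Y \<longrightarrow> Y \<in> B"
    using star unfolding star_comparable_def by blast
  have "cross_intersecting B A" using cross cross_intersecting_commute by blast
  then have "\<forall>X\<in>A. x \<in> X"
    using full_star_cross[OF prems(1) x A _ full] prems by simp
  then have cA: "card A = card (link x A)" by (rule card_link_star)
  have eqs: "card (S - {x}) - a = ?n - Suc a" using n' prems by simp
  have "card (link x A) + card (deletion x B) + ((card (S - {x}) - a + 1) choose b)
      \<le> (card (S - {x}) choose b) + tail_bound (card (S - {x}) - a) b r"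
  proof (rule step.IH)
    show "cross_intersecting (link x A) (deletion x B)"
      by (rule cross_intersecting_link_deletion[OF cross])
    show "(card (S - {x}) choose b) + r \<le> card (deletion x B) + ((card (S - {x}) - a + b) choose b)"
      using prems pascal linkB card_link_deletion[OF fin(2), of x] cards n' unfolding eqs by simp
    show "link x A \<subseteq> subsets_of_card (S - {x}) a" using link_subset[OF prems(1) A] by simp
  qed (use prems deletion_subset[OF B] n' cA cards in auto)
  then show ?case
    using pascal linkB card_link_deletion[OF fin(2), of x] cA cards n' unfolding eqs by simp
qed

theorem theorem6p3:
  fixes n a b r :: nat and \<A> \<B> :: "nat set set"
  assumes "n > 0" "a > 0" "b > 0" "r > 0" "n \<ge> a + b"
    and "\<A> \<subseteq> ksubsets n a" "\<B> \<subseteq> ksubsets n b"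
    and "cross_intersecting \<A> \<B>"
    and "(a < b \<and> card \<A> \<ge> r)
       \<or> (a = b \<and> card \<A> \<ge> r \<and> card \<B> \<ge> r)
       \<or> (a > b \<and> card \<A> \<ge> r \<and> card \<B> \<ge> (n choose b) - ((n - a + b) choose b) + r)"
  shows "(1 \<le> r \<and> r \<le> b - 1 \<longrightarrow>
            card \<A> + card \<B> \<le> (n choose b) - ((n - a + 1) choose b) + ((n - a - r + 1) choose (b - r)) + r)
       \<and> (b \<le> r \<and> r \<le> n - a + 1 \<longrightarrow>
            card \<A> + card \<B> \<le> (n choose b) - ((n - a + 1) choose b) + (n - a + 1))"
proof -
  have "ksubsets n k = subsets_of_card {1..n} k" for k
    by (simp add: ksubsets_def subsets_of_card_def)
  note fams = assms(6,7)[unfolded this] assms(8)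
  have bound: "card \<A> + card \<B> + ((n - a + 1) choose b) \<le> (n choose b) + tail_bound (n - a) b r"
    using assms(9)
  proof (elim disjE)
    assume "a < b \<and> card \<A> \<ge> r"
    then show ?thesis using bound_less[OF _ fams] assms by simp
  next
    assume "a = b \<and> card \<A> \<ge> r \<and> card \<B> \<ge> r"
    then show ?thesis using bound_equal[of "{1..n}" \<A> b \<B> r] fams assms by simp
  next
    assume large: "a > b \<and> card \<A> \<ge> r \<and> card \<B> \<ge> (n choose b) - ((n - a + b) choose b) + r"
    then have "(n choose b) + r \<le> card \<B> + ((n - a + b) choose b)" by linarith
    then show ?thesis using bound_ge[of "{1..n}" \<A> a \<B> b r] fams assms large by simp
  qed
  \<comment> \<open>Since \<open>a > 0\<close>, the subtraction in the claim is not truncated, and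
    the additive bound can be rearranged.\<close>
  have le: "(n - a + 1) choose b \<le> n choose b"
    using assms by (intro binomial_right_mono) simp
  show ?thesis
  proof (intro conjI impI)
    assume r: "1 \<le> r \<and> r \<le> b - 1"
    then have "n - a + 1 - r = n - a - r + 1" "r < b" using assms by auto
    then have "tail_bound (n - a) b r = ((n - a - r + 1) choose (b - r)) + r"
      by (simp add: tail_bound_def)
    then show "card \<A> + card \<B>
        \<le> (n choose b) - ((n - a + 1) choose b) + ((n - a - r + 1) choose (b - r)) + r"
      using bound le by linarith
  next
    assume "b \<le> r \<and> r \<le> n - a + 1"
    then have "tail_bound (n - a) b r = n - a + 1" by (simp add: tail_bound_def)
    then show "card \<A> + card \<B> \<le> (n choose b) - ((n - a + 1) choose b) + (n - a + 1)"
      using bound le by linarith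
  qed
qed

end
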